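(* Let $G=(V,E)$ be a finite graph with symmetric positive edge weights $w_{xy}=w_{yx}>0$ and a finite measure $\mu:V\to(0,\infty)$, let $\Delta$ be the associated $\mu$-Laplacian, and let $h:V\to\mathbb{R}$ be a function. Let $c_-(h)$ be the critical constant for the equation $\Delta u=c-he^{u}$ in $V$ with $c$ a negative constant. If $h(x)\le 0$ for all $x\in V$, but $h\not\equiv 0$, then $c_-(h)=-\infty$; that is, this equation has a solution $u:V\to\mathbb{R}$ for every constant $c<0$.
   Context: For $u:V\to\mathbb{R}$, the $\mu$-Laplacian is $\Delta u(x)=\frac{1}{\mu(x)}\sum_{y\sim x}w_{xy}(u(y)-u(x))$, where $y\sim x$ means $xy\in E$. For $h$ with $\sum_{x\in V}\mu(x)h(x)<0$, the critical constant $c_-(h)\in[-\infty,0)$ is the constant such that $\Delta u=c-he^u$ has a solution for every $c$ with $c_-(h)<c<0$ and has no solution for any $c<c_-(h)$.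
   Formalization: The finite graph G is assumed connected; without this the claim fails, since if h vanishes on a whole connected component, summing the equation against the measure over that component gives 0 = c times its measure, so no c<0 is solvable. *)

theory Defs
  imports Complex_Main "HOL-Library.Extended_Real" "Graph_Theory.Graph_Theory"
begin

text \<open>
  An undirected graph is a symmetric digraph: the edge \<open>xy\<close> is represented by the two arcs
  \<open>(x, y)\<close> and \<open>(y, x)\<close>. Loops are not excluded; they contribute nothing to the Laplacian.
  The weight \<open>w\<close> is only constrained on the edges, and \<open>\<mu>\<close> only on the vertices.
\<close>

definition finite_weighted_graph ::
    "'a pair_pre_digraph \<Rightarrow> ('a \<Rightarrow> 'a \<Rightarrow> real) \<Rightarrow> ('a \<Rightarrow> real) \<Rightarrow> bool" where
  "finite_weighted_graph G w \<mu> \<longleftrightarrow>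
     pair_pseudo_graph G \<and>
     (\<forall>(x, y) \<in> parcs G. w x y = w y x \<and> w x y > 0) \<and>
     (\<forall>x \<in> pverts G. \<mu> x > 0)"

definition mu_laplacian ::
    "'a pair_pre_digraph \<Rightarrow> ('a \<Rightarrow> 'a \<Rightarrow> real) \<Rightarrow> ('a \<Rightarrow> real) \<Rightarrow> ('a \<Rightarrow> real) \<Rightarrow> 'a \<Rightarrow> real" where
  "mu_laplacian G w \<mu> u x = 1 / \<mu> x * (\<Sum>y | (x, y) \<in> parcs G. w x y * (u y - u x))"

definition kazdan_warner_solution ::
    "'a pair_pre_digraph \<Rightarrow> ('a \<Rightarrow> 'a \<Rightarrow> real) \<Rightarrow> ('a \<Rightarrow> real) \<Rightarrow> ('a \<Rightarrow> real) \<Rightarrow> real \<Rightarrow>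
     ('a \<Rightarrow> real) \<Rightarrow> bool" where
  "kazdan_warner_solution G w \<mu> h c u \<longleftrightarrow>
     (\<forall>x \<in> pverts G. mu_laplacian G w \<mu> u x = c - h x * exp (u x))"

definition is_critical_constant ::
    "'a pair_pre_digraph \<Rightarrow> ('a \<Rightarrow> 'a \<Rightarrow> real) \<Rightarrow> ('a \<Rightarrow> real) \<Rightarrow> ('a \<Rightarrow> real) \<Rightarrow> ereal \<Rightarrow> bool" where
  "is_critical_constant G w \<mu> h k \<longleftrightarrow>
     k < 0 \<and>
     (\<forall>c. k < ereal c \<and> c < 0 \<longrightarrow> (\<exists>u. kazdan_warner_solution G w \<mu> h c u)) \<and>
     (\<forall>c. ereal c < k \<longrightarrow> \<not> (\<exists>u. kazdan_warner_solution G w \<mu> h c u))"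

lemma is_critical_constant_unique:
  assumes "is_critical_constant G w \<mu> h k" and "is_critical_constant G w \<mu> h k'"
  shows "k = k'"
proof -
  have False if a: "is_critical_constant G w \<mu> h a" and b: "is_critical_constant G w \<mu> h b"
    and "a < b" for a b
  proof -
    obtain c where c: "a < ereal c" "ereal c < b"
      using \<open>a < b\<close> ereal_dense2 by blast
    moreover have "c < 0"
      using c(2) b less_trans[of "ereal c" b 0] by (simp add: is_critical_constant_def)
    ultimately show False
      using a b by (auto simp: is_critical_constant_def)
  qed
  then show ?thesis
    using assms by (meson linorder_neqE)
qed

text \<open>
  The constant $c_-(h)$. By the preceding lemma there is at most one; where there is none, as may
  happen when \<open>(\<Sum>x \<in> pverts G. \<mu> x * h x) \<ge> 0\<close>, the value is unspecified.
\<close>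

definition critical_constant ::
    "'a pair_pre_digraph \<Rightarrow> ('a \<Rightarrow> 'a \<Rightarrow> real) \<Rightarrow> ('a \<Rightarrow> real) \<Rightarrow> ('a \<Rightarrow> real) \<Rightarrow> ereal" where
  "critical_constant G w \<mu> h = (THE k. is_critical_constant G w \<mu> h k)"

end

theory Submission
  imports Defs
begin

text \<open>
  Perron's method. Since \<open>h \<le> 0\<close>, every subsolution satisfies \<open>\<Delta>u \<ge> c\<close>; propagating this
  inequality along paths that start at a maximum point of \<open>u\<close> bounds the oscillation of \<open>u\<close> below
  that maximum by a constant independent of \<open>u\<close>. At a vertex with \<open>h x < 0\<close> the exponential term
  then bounds \<open>u x\<close>, so subsolutions are uniformly bounded above. Very negative constants are
  subsolutions, hence the pointwise supremum of all subsolutions is finite. It is a subsolution,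
  and if the inequality were strict at a vertex, the value there could be raised a little.
\<close>

definition kazdan_warner_subsolution ::
    "'a pair_pre_digraph \<Rightarrow> ('a \<Rightarrow> 'a \<Rightarrow> real) \<Rightarrow> ('a \<Rightarrow> real) \<Rightarrow> ('a \<Rightarrow> real) \<Rightarrow> real \<Rightarrow>
     ('a \<Rightarrow> real) \<Rightarrow> bool" where
  "kazdan_warner_subsolution G w \<mu> h c u \<longleftrightarrow>
     (\<forall>x \<in> pverts G. c - h x * exp (u x) \<le> mu_laplacian G w \<mu> u x)"

lemma finite_weighted_graphD:
  assumes "finite_weighted_graph G w \<mu>"
  shows "finite (pverts G)" and "finite {y. (x, y) \<in> parcs G}"
    and "(x, y) \<in> parcs G \<Longrightarrow> x \<in> pverts G" and "(x, y) \<in> parcs G \<Longrightarrow> y \<in> pverts G"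
    and "(x, y) \<in> parcs G \<Longrightarrow> w x y > 0" and "x \<in> pverts G \<Longrightarrow> \<mu> x > 0"
proof -
  interpret pair_pseudo_graph G
    using assms by (simp add: finite_weighted_graph_def)
  show "finite (pverts G)" by (rule pair_finite_verts)
  have "{y. (x, y) \<in> parcs G} \<subseteq> snd ` parcs G" by force
  then show "finite {y. (x, y) \<in> parcs G}"
    using pair_finite_arcs finite_surj by blast
  show "(x, y) \<in> parcs G \<Longrightarrow> x \<in> pverts G" "(x, y) \<in> parcs G \<Longrightarrow> y \<in> pverts G"
    using arc_fst_in_verts arc_snd_in_verts by fastforce+
  show "(x, y) \<in> parcs G \<Longrightarrow> w x y > 0" "x \<in> pverts G \<Longrightarrow> \<mu> x > 0"
    using assms by (auto simp: finite_weighted_graph_def)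
qed

lemma mu_laplacian_eq_sum_times:
  assumes "finite_weighted_graph G w \<mu>" and "x \<in> pverts G"
  shows "\<mu> x * mu_laplacian G w \<mu> u x = (\<Sum>y | (x, y) \<in> parcs G. w x y * (u y - u x))"
  using finite_weighted_graphD(6)[OF assms] by (simp add: mu_laplacian_def)

lemma mu_laplacian_le:
  assumes "finite_weighted_graph G w \<mu>" and "x \<in> pverts G"
    and "\<And>y. (x, y) \<in> parcs G \<Longrightarrow> u y - u x \<le> v y - v x"
  shows "mu_laplacian G w \<mu> u x \<le> mu_laplacian G w \<mu> v x"
proof -
  have "\<mu> x * mu_laplacian G w \<mu> u x \<le> \<mu> x * mu_laplacian G w \<mu> v x"
    unfolding mu_laplacian_eq_sum_times[OF assms(1,2)]
    using assms(3) finite_weighted_graphD(5)[OF assms(1)]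
    by (intro sum_mono mult_left_mono) (auto simp: less_imp_le)
  then show ?thesis
    using finite_weighted_graphD(6)[OF assms(1,2)] by simp
qed

lemma mu_laplacian_le_gap:
  assumes "finite_weighted_graph G w \<mu>" and "x \<in> pverts G"
    and "\<And>y. (x, y) \<in> parcs G \<Longrightarrow> u y \<le> u x + C"
  shows "\<mu> x * mu_laplacian G w \<mu> u x \<le> (\<Sum>y | (x, y) \<in> parcs G. w x y * C)"
  unfolding mu_laplacian_eq_sum_times[OF assms(1,2)]
  using assms(3) finite_weighted_graphD(5)[OF assms(1)]
  by (intro sum_mono mult_left_mono) (auto simp: less_imp_le algebra_simps)

lemma subsolution_lower_bound:
  assumes "\<forall>x \<in> pverts G. h x \<le> 0" and "kazdan_warner_subsolution G w \<mu> h c u" and "x \<in> pverts G"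
  shows "c \<le> mu_laplacian G w \<mu> u x"
proof -
  have "h x * exp (u x) \<le> 0"
    using assms(1,3) by (simp add: mult_nonpos_nonneg)
  then show ?thesis
    using assms(2,3) by (force simp: kazdan_warner_subsolution_def)
qed

text \<open>Induction along a path from the maximum point \<open>x\<close>. If \<open>u y\<close>
  lies within \<open>C\<close> of the maximum, no neighbour exceeds \<open>u y\<close> by more than
  \<open>C\<close>, so \<Delta>u(y) \<ge> c keeps any single neighbour from lying far below. The
  order of quantifiers matters: \<open>C\<close> is chosen before \<open>u\<close>.\<close>

lemma subsolution_gap_from_max:
  assumes G: "finite_weighted_graph G w \<mu>" and h: "\<forall>x \<in> pverts G. h x \<le> 0"
    and "reachable (with_proj G) x y"
  shows "\<exists>C. \<forall>u. kazdan_warner_subsolution G w \<mu> h c u \<longrightarrow> (\<forall>z \<in> pverts G. u z \<le> u x) \<longrightarrow>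
           u x \<le> u y + C"
proof -
  interpret pair_pseudo_graph G
    using G by (simp add: finite_weighted_graph_def)
  show ?thesis using assms(3)
  proof (induct rule: reachable_induct)
    case base
    then show ?case by (intro exI[of _ 0]) simp
  next
    case (step y z)
    then obtain C where C: "\<And>u. kazdan_warner_subsolution G w \<mu> h c u \<Longrightarrow>
        \<forall>z \<in> pverts G. u z \<le> u x \<Longrightarrow> u x \<le> u y + C"
      by blast
    note D = finite_weighted_graphD[OF G]
    let ?N = "{v. (y, v) \<in> parcs G}"
    \<comment> \<open>The most that the neighbours of \<open>y\<close> other than \<open>z\<close>
      can contribute to \<open>\<mu> y\<close> times the Laplacian. The edge to \<open>z\<close> has
      to supply the rest, at least \<open>\<mu> y * c - R\<close>, and dividing by
      \<open>w y z\<close> gives the new constant.\<close>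
    define R where "R = (\<Sum>v \<in> ?N - {z}. w y v * C)"
    have yz: "(y, z) \<in> parcs G" using step by simp
    have "u x \<le> u z + (C - (\<mu> y * c - R) / w y z)"
      if u: "kazdan_warner_subsolution G w \<mu> h c u" and max: "\<forall>z \<in> pverts G. u z \<le> u x" for u
    proof -
      have "\<mu> y * c \<le> \<mu> y * mu_laplacian G w \<mu> u y"
        using subsolution_lower_bound[OF h u D(3)[OF yz]] D(6)[OF D(3)[OF yz]] by simp
      also have "\<dots> = w y z * (u z - u y) + (\<Sum>v \<in> ?N - {z}. w y v * (u v - u y))"
        unfolding mu_laplacian_eq_sum_times[OF G D(3)[OF yz]]
        using yz D(2) by (simp add: sum.remove)
      also have "(\<Sum>v \<in> ?N - {z}. w y v * (u v - u y)) \<le> R"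
        unfolding R_def
      proof (intro sum_mono mult_left_mono)
        fix v assume "v \<in> ?N - {z}"
        then have v: "(y, v) \<in> parcs G" by simp
        show "0 \<le> w y v" using D(5)[OF v] by simp
        show "u v - u y \<le> C" using max D(4)[OF v] C[OF u max] by fastforce
      qed
      finally have "(\<mu> y * c - R) / w y z \<le> u z - u y"
        using D(5)[OF yz] by (simp add: divide_le_eq mult.commute)
      then show ?thesis using C[OF u max] by linarith
    qed
    then show ?case by blast
  qed
qed

text \<open>At a vertex \<open>p\<close> with \<open>h p < 0\<close>, the gap estimate bounds
  \<Delta>u(p) from above, and -h(p) exp(u(p)) \<le> \<Delta>u(p) - c then bounds
  \<open>u p\<close>. Adding the gap bounds the maximum of \<open>u\<close>.\<close>

lemma subsolutions_bounded:
  assumes G: "finite_weighted_graph G w \<mu>" and conn: "Digraph_Component.connected (with_proj G)"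
    and h: "\<forall>x \<in> pverts G. h x \<le> 0" and "\<exists>x \<in> pverts G. h x \<noteq> 0"
  shows "\<exists>B. \<forall>u. kazdan_warner_subsolution G w \<mu> h c u \<longrightarrow> (\<forall>x \<in> pverts G. u x \<le> B)"
proof -
  note D = finite_weighted_graphD[OF G]
  interpret pair_pseudo_graph G
    using G by (simp add: finite_weighted_graph_def)
  obtain p where p: "p \<in> pverts G" "h p < 0"
    using assms(3,4) by force
  \<comment> \<open>Arcs come in opposite pairs, so connectedness yields directed paths.\<close>
  have reach: "reachable (with_proj G) x p" if "x \<in> pverts G" for x
    using symmetric_connected_imp_strongly_connected[OF pair_sym_arcs conn] that p(1)
    by (simp add: strongly_connected_def)
  have "\<forall>x \<in> pverts G. \<exists>C. \<forall>u. kazdan_warner_subsolution G w \<mu> h c u \<longrightarrow>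
      (\<forall>z \<in> pverts G. u z \<le> u x) \<longrightarrow> u x \<le> u p + C"
    using subsolution_gap_from_max[OF G h reach] by blast
  then obtain C where C: "\<And>u x. x \<in> pverts G \<Longrightarrow> kazdan_warner_subsolution G w \<mu> h c u \<Longrightarrow>
      \<forall>z \<in> pverts G. u z \<le> u x \<Longrightarrow> u x \<le> u p + C x"
    by metis
  \<comment> \<open>The subsolution inequality at \<open>p\<close>, solved for
    \<open>exp (u p)\<close>. The maximum point \<open>x\<close> varies with \<open>u\<close>, so
    \<open>B\<close> is taken over all vertices.\<close>
  define K where "K x = ((\<Sum>y | (p, y) \<in> parcs G. w p y * C x) / \<mu> p - c) / (- h p)" for x
  define B where "B = Max ((\<lambda>x. K x + C x) ` pverts G)"
  have "u y \<le> B" if u: "kazdan_warner_subsolution G w \<mu> h c u" and y: "y \<in> pverts G" for u y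
  proof -
    have "Max (u ` pverts G) \<in> u ` pverts G"
      using D(1) y by (intro Max_in) auto
    then obtain x where x: "x \<in> pverts G" "u x = Max (u ` pverts G)"
      by auto
    have max: "\<forall>z \<in> pverts G. u z \<le> u x"
      using D(1) x(2) by simp
    have gap: "u x \<le> u p + C x"
      by (rule C[OF x(1) u max])
    have "\<mu> p * mu_laplacian G w \<mu> u p \<le> (\<Sum>y | (p, y) \<in> parcs G. w p y * C x)"
      using max gap D(4) by (intro mu_laplacian_le_gap[OF G p(1)]) (meson order_trans)
    then have "mu_laplacian G w \<mu> u p \<le> (\<Sum>y | (p, y) \<in> parcs G. w p y * C x) / \<mu> p"
      using D(6)[OF p(1)] by (simp add: le_divide_eq mult.commute)
    moreover have "c - h p * exp (u p) \<le> mu_laplacian G w \<mu> u p"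
      using u p(1) by (simp add: kazdan_warner_subsolution_def)
    ultimately have "exp (u p) * (- h p) \<le> (\<Sum>y | (p, y) \<in> parcs G. w p y * C x) / \<mu> p - c"
      by (simp add: mult.commute)
    then have "exp (u p) \<le> K x"
      unfolding K_def using p(2) by (subst pos_le_divide_eq) auto
    \<comment> \<open>The crude estimate t \<le> exp t replaces a logarithm.\<close>
    then have "u p \<le> K x"
      using exp_ge_add_one_self[of "u p"] by linarith
    then have "u x \<le> K x + C x"
      using gap by linarith
    also have "\<dots> \<le> B"
      unfolding B_def using D(1) x(1) by simp
    finally show ?thesis
      using max y by force
  qed
  then show ?thesis by blast
qed

text \<open>The Laplacian of a constant vanishes, so it suffices that -h exp(k) \<le> -c everywhere,
  which holds once exp(k) is small.\<close>

lemma constant_subsolution: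
  assumes "finite_weighted_graph G w \<mu>" and "c < 0"
  shows "\<exists>k. kazdan_warner_subsolution G w \<mu> h c (\<lambda>_. k)"
proof -
  note fin = finite_weighted_graphD(1)[OF assms(1)]
  \<comment> \<open>The summand 1 keeps the bound \<open>H\<close> on \<bar>h\<bar> positive, so
    that \<open>- c / H\<close> has a logarithm.\<close>
  define H where "H = (\<Sum>x \<in> pverts G. \<bar>h x\<bar>) + 1"
  have H: "\<bar>h x\<bar> \<le> H" if "x \<in> pverts G" for x
    using member_le_sum[OF that, of "\<lambda>x. \<bar>h x\<bar>"] fin by (simp add: H_def)
  have "H > 0"
    by (simp add: H_def add_nonneg_pos sum_nonneg)
  define k where "k = ln (- c / H)"
  have k: "exp k = - c / H"
    using \<open>H > 0\<close> assms(2) by (simp add: k_def divide_neg_pos)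
  have "- h x * exp k \<le> - c" if "x \<in> pverts G" for x
  proof -
    have "- h x * exp k \<le> H * exp k"
      using H[OF that] by (intro mult_right_mono) auto
    then show ?thesis
      using \<open>H > 0\<close> k by simp
  qed
  then show ?thesis
    by (intro exI[of _ k]) (force simp: kazdan_warner_subsolution_def mu_laplacian_def)
qed

text \<open>If the inequality failed for \<open>U\<close> at \<open>x\<close>, continuity would make
  it fail with the centre value lowered slightly to \<open>u x\<close>, for a subsolution
  \<open>u\<close> nearly attaining the supremum at \<open>x\<close>. Lowering the neighbour values
  from \<open>U\<close> to \<open>u\<close> only decreases the Laplacian, so it would fail for
  \<open>u\<close> too.\<close>

lemma sup_subsolutions_is_subsolution:
  assumes G: "finite_weighted_graph G w \<mu>"
    and ne: "\<exists>u. kazdan_warner_subsolution G w \<mu> h c u"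
    and bdd: "\<And>x. x \<in> pverts G \<Longrightarrow> bdd_above ((\<lambda>u. u x) ` Collect (kazdan_warner_subsolution G w \<mu> h c))"
  defines "U \<equiv> \<lambda>x. SUP u \<in> Collect (kazdan_warner_subsolution G w \<mu> h c). u x"
  shows "kazdan_warner_subsolution G w \<mu> h c U"
  unfolding kazdan_warner_subsolution_def
proof (rule ballI, rule ccontr)
  fix x
  assume x: "x \<in> pverts G" and neg: "\<not> c - h x * exp (U x) \<le> mu_laplacian G w \<mu> U x"
  note D = finite_weighted_graphD[OF G]
  let ?S = "Collect (kazdan_warner_subsolution G w \<mu> h c)"
  have le: "u y \<le> U y" if "u \<in> ?S" "y \<in> pverts G" for u y
    unfolding U_def using that bdd by (intro cSUP_upper) auto
  \<comment> \<open>Only the centre value varies; the neighbours stay at \<open>U\<close>. A loop at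
    \<open>x\<close> contributes a term that vanishes at \<open>t = U x\<close> and is nonnegative
    below it.\<close>
  define g where
    "g t = 1 / \<mu> x * (\<Sum>y | (x, y) \<in> parcs G. w x y * (U y - t)) - (c - h x * exp t)" for t
  have "isCont g (U x)"
    unfolding g_def by (intro continuous_intros)
  moreover have "g (U x) < 0"
    using neg by (simp add: g_def mu_laplacian_def)
  ultimately have "eventually (\<lambda>t. g t < 0) (nhds (U x))"
    by (simp add: isCont_def order_tendstoD(2) tendsto_at_iff_tendsto_nhds)
  then obtain d where d: "d > 0" "\<And>t. dist t (U x) < d \<Longrightarrow> g t < 0"
    by (auto simp: eventually_nhds_metric)
  obtain u where u: "u \<in> ?S" "U x - d < u x"
    using ne d(1) less_cSUP_iff[OF _ bdd[OF x], of "U x - d"] unfolding U_def by auto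
  have "dist (u x) (U x) < d"
    using le[OF u(1) x] u(2) by (simp add: dist_real_def)
  then have "g (u x) < 0" by (rule d(2))
  moreover have "c - h x * exp (u x) \<le> mu_laplacian G w \<mu> u x"
    using u(1) x by (simp add: kazdan_warner_subsolution_def)
  moreover have "mu_laplacian G w \<mu> u x \<le> 1 / \<mu> x * (\<Sum>y | (x, y) \<in> parcs G. w x y * (U y - u x))"
    unfolding mu_laplacian_def
    using D(5) D(6)[OF x] le[OF u(1) D(4)]
    by (intro mult_left_mono sum_mono) (auto simp: less_imp_le)
  ultimately show False by (simp add: g_def)
qed

lemma kazdan_warner_solution_exists:
  assumes G: "finite_weighted_graph G w \<mu>" and conn: "Digraph_Component.connected (with_proj G)"
    and h: "\<forall>x \<in> pverts G. h x \<le> 0" "\<exists>x \<in> pverts G. h x \<noteq> 0" and c: "c < 0"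
  shows "\<exists>u. kazdan_warner_solution G w \<mu> h c u"
proof -
  let ?S = "Collect (kazdan_warner_subsolution G w \<mu> h c)"
  define U where "U x = (SUP u \<in> ?S. u x)" for x
  obtain B where B: "\<And>u x. u \<in> ?S \<Longrightarrow> x \<in> pverts G \<Longrightarrow> u x \<le> B"
    using subsolutions_bounded[OF G conn h] by blast
  have bdd: "bdd_above ((\<lambda>u. u x) ` ?S)" if "x \<in> pverts G" for x
    using B that by (intro bdd_aboveI[of _ B]) auto
  have U: "kazdan_warner_subsolution G w \<mu> h c U"
    unfolding U_def using constant_subsolution[OF G c] bdd
    by (intro sup_subsolutions_is_subsolution[OF G]) auto
  have "mu_laplacian G w \<mu> U x = c - h x * exp (U x)" if x: "x \<in> pverts G" for x
  proof (rule ccontr)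
    assume "mu_laplacian G w \<mu> U x \<noteq> c - h x * exp (U x)"
    then have strict: "c - h x * exp (U x) < mu_laplacian G w \<mu> U x"
      using U x by (force simp: kazdan_warner_subsolution_def)
    \<comment> \<open>The slack at \<open>x\<close> after resetting the value there to
      \<open>t\<close>; by continuity it stays positive for some \<open>t\<close> above
      \<open>U x\<close>.\<close>
    define g where "g t = mu_laplacian G w \<mu> (U(x := t)) x - (c - h x * exp t)" for t
    have "isCont (\<lambda>t. (U(x := t)) y) (U x)" for y
      by (cases "y = x") auto
    then have "isCont g (U x)"
      unfolding g_def mu_laplacian_def by (intro continuous_intros) auto
    moreover have "g (U x) > 0"
      using strict by (simp add: g_def)
    ultimately have "eventually (\<lambda>t. g t > 0) (nhds (U x))"
      by (simp add: isCont_def order_tendstoD(1) tendsto_at_iff_tendsto_nhds)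
    then obtain d where d: "d > 0" "\<And>t. dist t (U x) < d \<Longrightarrow> g t > 0"
      by (auto simp: eventually_nhds_metric)
    define t where "t = U x + d / 2"
    have t: "U x < t" "g t > 0"
      using d by (auto simp: t_def dist_real_def)
    \<comment> \<open>At other vertices, raising the value at \<open>x\<close> can only increase the
      Laplacian and leaves the right-hand side unchanged.\<close>
    have "c - h z * exp ((U(x := t)) z) \<le> mu_laplacian G w \<mu> (U(x := t)) z"
      if z: "z \<in> pverts G" for z
    proof (cases "z = x")
      case True
      then show ?thesis using t(2) by (simp add: g_def)
    next
      case False
      have "c - h z * exp (U z) \<le> mu_laplacian G w \<mu> U z"
        using U z by (simp add: kazdan_warner_subsolution_def)
      also have "\<dots> \<le> mu_laplacian G w \<mu> (U(x := t)) z"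
        using False t(1) by (intro mu_laplacian_le[OF G z]) auto
      finally show ?thesis using False by simp
    qed
    then have "U(x := t) \<in> ?S"
      by (simp add: kazdan_warner_subsolution_def)
    \<comment> \<open>The raised function is itself one of the competitors in the supremum.\<close>
    then have "(U(x := t)) x \<le> U x"
      unfolding U_def[of x] by (intro cSUP_upper bdd[OF x])
    then show False using t(1) by simp
  qed
  then show ?thesis by (auto simp: kazdan_warner_solution_def)
qed

text \<open>Connectedness is what rules out a component where \<open>h\<close> vanishes: summing
  \<mu>\<Delta>u over it gives 0, whereas c times its measure is negative.\<close>

theorem theorem4:
  fixes G :: "'a pair_pre_digraph"
    and w :: "'a \<Rightarrow> 'a \<Rightarrow> real"
    and \<mu> h :: "'a \<Rightarrow> real"
  assumes "finite_weighted_graph G w \<mu>"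
    and "Digraph_Component.connected (with_proj G)"
    and "\<forall>x \<in> pverts G. h x \<le> 0"
    and "\<exists>x \<in> pverts G. h x \<noteq> 0"
  shows "critical_constant G w \<mu> h = -\<infinity> \<and>
         (\<forall>c < 0. \<exists>u :: 'a \<Rightarrow> real. kazdan_warner_solution G w \<mu> h c u)"
proof
  show ex: "\<forall>c < 0. \<exists>u. kazdan_warner_solution G w \<mu> h c u"
    using kazdan_warner_solution_exists[OF assms] by blast
  \<comment> \<open>No real number lies below -\<infinity>, so the nonexistence clause is
    vacuous.\<close>
  then have "is_critical_constant G w \<mu> h (-\<infinity>)"
    by (simp add: is_critical_constant_def)
  then show "critical_constant G w \<mu> h = -\<infinity>"
    unfolding critical_constant_def
    by (intro the_equality is_critical_constant_unique)
qed

end
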